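(* Let $n,m\ge 1$, let $\mathcal G=(\mathcal V,\mathcal E)$ be an undirected graph with $\mathcal V=\{1,\dots,n\}$ and neighbor sets $\mathcal N_i=\{j : (i,j)\in\mathcal E\}$, let $f_i:\mathbb R^m\to\mathbb R$ and $\Omega_i\subset\mathbb R^m$ for $i\in\mathcal V$, and let $K\ge 0$. Assume: (1) for each $i\in\mathcal V$, $f_i$ is convex on an open (convex) set containing $\Omega_i$, $\Omega_i$ is convex and compact, and $\bigcap_{i=1}^n \mathrm{int}(\Omega_i)\neq\emptyset$; (2) there is a constant $c>0$ such that $|f_i(x)-f_i(y)|\le c\|x-y\|$ for all $x,y\in\Omega_i$ and all $i\in\mathcal V$; (3) $\mathcal G$ is connected. Let $\bar\Omega=\Omega_1\times\dots\times\Omega_n$ and, for $\bm x=(x_1,\dots,x_n)$, $$\mathcal L(\bm x)=\sum_{i=1}^n f_i(x_i)+\frac K2\sum_{i=1}^n\sum_{j\in\mathcal N_i}|x_i-x_j| .$$ Let $\bm x(t)$, $t\ge0$, be a solution of the dynamics $$\dot{\bm x}(t)\in P_{\mathcal T_{\bar\Omega}(\bm x(t))}\big[-\partial\mathcal L(\bm x(t))\big],\qquad \bm x(0)=\bm x_0\in\bar\Omega .$$ Then $\bm x(t)$ converges as $t\to\infty$ to an equilibrium point $\bm x^*$ of the dynamics, which is also an optimal solution of the problem of minimizing $\mathcal L(\bm x)$ subject to $\bm x\in\bar\Omega$.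
   Context: $\|\cdot\|$ is the Euclidean norm and $|\cdot|$ applied to a vector is the $l_1$-norm. $\partial$ denotes the subdifferential of a convex function: $g\in\partial f(x)$ iff $f(y)\ge f(x)+\langle y-x,g\rangle$ for all $y$ in the (open convex) domain on which $f$ is convex. For a closed convex set $\Omega$ and $x\in\Omega$, the tangent cone is $\mathcal T_\Omega(x)=\{\lim_{k\to\infty}(x_k-x)/\tau_k : x_k\in\Omega,\ x_k\to x,\ \tau_k>0,\ \tau_k\to0\}$, and $P_{\mathcal T_\Omega(x)}(y)$ is the Euclidean projection of $y$ onto $\mathcal T_\Omega(x)$. For a set $S$, $P_{\mathcal T_\Omega(x)}[S]=\{P_{\mathcal T_\Omega(x)}(y): y\in S\}$. A (Caratheodory) solution of a differential inclusion $\dot x\in\mathcal F(x)$ is an absolutely continuous function (on compact intervals) satisfying the inclusion for almost every $t$. A point $x_e$ is an equilibrium point if $0\in\mathcal F(x_e)$. Written agent by agent, the dynamics reads $\dot x_i\in P_{\mathcal T_{\Omega_i}(x_i)}[-\partial f_i(x_i)-K\sum_{j\in\mathcal N_i}\mathrm{Sgn}(x_i-x_j)]$, where $\mathrm{Sgn}$ is the entrywise set-valued sign ($\{1\}$, $[-1,1]$, $\{-1\}$ for positive, zero, negative entries), the selections for $(i,j)$ and $(j,i)$ being opposite, since together they form an element of $\partial\mathcal L(\bm x)$. *)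

theory Defs
  imports "HOL-Analysis.Analysis"
begin

definition l1_norm :: "real ^ 'm \<Rightarrow> real" where
  "l1_norm v = (\<Sum>k\<in>UNIV. \<bar>v $ k\<bar>)"

text \<open>
  The function is total, but only its values on the domain \<open>D\<close> (on which it is convex) enter.
\<close>

definition subdifferential :: "'a::real_inner set \<Rightarrow> ('a \<Rightarrow> real) \<Rightarrow> 'a \<Rightarrow> 'a set" where
  "subdifferential D f x = {g. \<forall>y\<in>D. f y \<ge> f x + (y - x) \<bullet> g}"

definition tangent_cone :: "'a::real_normed_vector set \<Rightarrow> 'a \<Rightarrow> 'a set" where
  "tangent_cone \<Omega> x =
    {v. \<exists>(X :: nat \<Rightarrow> 'a) (\<tau> :: nat \<Rightarrow> real).
          (\<forall>k. X k \<in> \<Omega>) \<and> X \<longlonglongrightarrow> x \<and> (\<forall>k. \<tau> k > 0) \<and> \<tau> \<longlonglongrightarrow> 0 \<and>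
          (\<lambda>k. (X k - x) /\<^sub>R \<tau> k) \<longlonglongrightarrow> v}"

text \<open>
  The right-hand side of the projected subgradient dynamics: the projections of the negated
  subgradients onto the tangent cone. The tangent cone is only meant for points of \<open>\<Omega>\<close>, and
  \<^const>\<open>closest_point\<close> is unspecified on the empty set, so the value outside \<open>\<Omega>\<close> is set to be empty.
\<close>

definition projected_subgradient ::
    "'a::euclidean_space set \<Rightarrow> 'a set \<Rightarrow> ('a \<Rightarrow> real) \<Rightarrow> 'a \<Rightarrow> 'a set" where
  "projected_subgradient D \<Omega> f x =
    (if x \<in> \<Omega> then (\<lambda>g. closest_point (tangent_cone \<Omega> x) (- g)) ` subdifferential D f x else {})"

text \<open>
  \<^const>\<open>division_of\<close> supplies finite families of nonoverlapping compact intervals; the interval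
  \<open>K\<close> is \<open>[Inf K, Sup K]\<close>.
\<close>

definition absolutely_continuous_on :: "real set \<Rightarrow> (real \<Rightarrow> 'a::real_normed_vector) \<Rightarrow> bool" where
  "absolutely_continuous_on S x \<longleftrightarrow>
    (\<forall>\<epsilon>>0. \<exists>\<delta>>0. \<forall>d. d division_of \<Union>d \<and> \<Union>d \<subseteq> S \<and> (\<Sum>K\<in>d. Sup K - Inf K) < \<delta> \<longrightarrow>
       (\<Sum>K\<in>d. norm (x (Sup K) - x (Inf K))) < \<epsilon>)"

definition caratheodory_solution ::
    "('a::real_normed_vector \<Rightarrow> 'a set) \<Rightarrow> (real \<Rightarrow> 'a) \<Rightarrow> bool" where
  "caratheodory_solution F x \<longleftrightarrow>
    (\<forall>T\<ge>0. absolutely_continuous_on {0..T} x) \<and>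
    (AE t in lebesgue. 0 \<le> t \<longrightarrow>
       (\<exists>v. (x has_vector_derivative v) (at t within {0..}) \<and> v \<in> F (x t)))"

definition equilibrium_point :: "('a::zero \<Rightarrow> 'a set) \<Rightarrow> 'a \<Rightarrow> bool" where
  "equilibrium_point F x \<longleftrightarrow> 0 \<in> F x"

definition product_set :: "('n \<Rightarrow> 'a set) \<Rightarrow> ('a ^ 'n) set" where
  "product_set S = {x. \<forall>i. x $ i \<in> S i}"

definition neighbors :: "('n \<times> 'n) set \<Rightarrow> 'n \<Rightarrow> 'n set" where
  "neighbors E i = {j. (i, j) \<in> E}"

definition connected_graph :: "('n \<times> 'n) set \<Rightarrow> bool" where
  "connected_graph E \<longleftrightarrow> (\<forall>i j. (i, j) \<in> E\<^sup>*)"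

definition penalized_cost ::
    "('n \<times> 'n) set \<Rightarrow> real \<Rightarrow> ('n \<Rightarrow> real ^ 'm \<Rightarrow> real) \<Rightarrow> (real ^ 'm) ^ 'n \<Rightarrow> real" where
  "penalized_cost E K f x =
    (\<Sum>i\<in>UNIV. f i (x $ i)) + K / 2 * (\<Sum>i\<in>UNIV. \<Sum>j\<in>neighbors E i. l1_norm (x $ i - x $ j))"

end

theory Submission
  imports Defs
begin

text \<open>
  Every point \<open>y\<close> of the constraint set yields a Lyapunov inequality. A point of the right-hand side
  has the form \<open>v = P(- g)\<close>, where \<open>P\<close> projects onto the tangent cone at \<open>x\<close> and \<open>g\<close> is a
  subgradient. The residual \<open>- g - v\<close> makes a nonpositive inner product with \<open>y - x\<close>, which lies
  in the cone, and therefore \<open>(x - y) \<bullet> v \<le> (y - x) \<bullet> (- g) \<le> L y - L x\<close>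
  (\<open>projected_subgradient_dissipation\<close>). Along a solution this bounds the derivative of
  \<open>\<parallel>x(t) - y\<parallel>\<^sup>2 / 2\<close> for almost every \<open>t\<close>, and absolute continuity turns the bound on the
  derivative into a bound on increments (\<open>absolutely_continuous_increment_le\<close>).

  If \<open>y\<close> is a minimizer, then first of all the distance to \<open>y\<close> does not increase; moreover the
  cost comes arbitrarily close to its minimum along the solution, because otherwise
  \<open>\<parallel>x(t) - y\<parallel>\<^sup>2\<close> would decrease at a fixed positive rate and become negative. By compactness some
  sequence of points \<open>x(t\<^sub>k)\<close> converges to a minimizer \<open>x\<^sup>*\<close>. The distance to this particular
  minimizer is nonincreasing and arbitrarily small, so the whole trajectory converges to it
  (an Opial-type argument).

  That a minimizer is an equilibrium is the optimality condition of convex programming: separating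
  the strict epigraph of the cost from the constraint set placed at the level of the minimum gives
  a subgradient \<open>g\<close> such that \<open>- g\<close> is normal to the constraint set, and such a vector projects to
  \<open>0\<close> on the tangent cone (\<open>minimizer_imp_equilibrium\<close>).
\<close>

section \<open>Tangent cones of convex sets\<close>

text \<open>
  The description as a closed conic hull gives at once that the tangent cone is closed, convex and
  invariant under nonnegative scaling, none of which is apparent from the definition by sequences.
\<close>

lemma tangent_cone_eq_closure_conic_hull:
  fixes \<Omega> :: "'a::real_normed_vector set"
  assumes "convex \<Omega>" "x \<in> \<Omega>"
  shows "tangent_cone \<Omega> x = closure (conic hull ((\<lambda>y. y - x) ` \<Omega>))"
proof (intro subset_antisym subsetI)
  fix v assume "v \<in> tangent_cone \<Omega> x"
  then obtain X and \<tau> :: "nat \<Rightarrow> real" where X: "\<And>k. X k \<in> \<Omega>" "\<And>k. \<tau> k > 0"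
    and lim: "(\<lambda>k. (X k - x) /\<^sub>R \<tau> k) \<longlonglongrightarrow> v"
    unfolding tangent_cone_def by auto
  have "(X k - x) /\<^sub>R \<tau> k \<in> conic hull ((\<lambda>y. y - x) ` \<Omega>)" for k
    unfolding conic_hull_explicit using X[of k] by (auto intro!: exI[of _ "inverse (\<tau> k)"])
  with lim show "v \<in> closure (conic hull ((\<lambda>y. y - x) ` \<Omega>))"
    unfolding closure_sequential by (intro exI[of _ "\<lambda>k. (X k - x) /\<^sub>R \<tau> k"]) simp
next
  fix v assume "v \<in> closure (conic hull ((\<lambda>y. y - x) ` \<Omega>))"
  then obtain w where w: "\<And>k. w k \<in> conic hull ((\<lambda>y. y - x) ` \<Omega>)" and lim: "w \<longlonglongrightarrow> v"
    unfolding closure_sequential by blast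
  have "\<exists>s y. 0 \<le> s \<and> y \<in> \<Omega> \<and> w k = s *\<^sub>R (y - x)" for k
    using w[of k] unfolding conic_hull_explicit by auto
  then obtain s y where sy: "\<And>k. 0 \<le> s k" "\<And>k. y k \<in> \<Omega>" "\<And>k. w k = s k *\<^sub>R (y k - x)"
    by metis
  \<comment> \<open>The second factor keeps \<open>x + \<tau> k * w k\<close> on the segment from \<open>x\<close> to \<open>y k\<close>; the first one
      makes these points tend to \<open>x\<close>.\<close>
  define \<tau> where "\<tau> k = inverse (real (Suc k)) * inverse (1 + s k)" for k
  define X where "X k = x + \<tau> k *\<^sub>R w k" for k
  have pos: "\<tau> k > 0" for k
    unfolding \<tau>_def using sy(1)[of k] by (intro mult_pos_pos) (auto simp: add_pos_nonneg)
  have \<tau>_le: "\<tau> k \<le> inverse (real (Suc k))" for k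
    unfolding \<tau>_def using sy(1)[of k] by (intro mult_left_le) (auto simp: field_simps)
  have \<tau>_lim: "\<tau> \<longlonglongrightarrow> 0"
    by (rule tendsto_sandwich[OF _ _ tendsto_const LIMSEQ_inverse_real_of_nat])
       (use pos \<tau>_le in \<open>auto intro!: always_eventually less_imp_le\<close>)
  have "X k \<in> \<Omega>" for k
  proof -
    have "inverse (1 + s k) * s k \<le> 1"
      using sy(1)[of k] by (auto simp: field_simps)
    moreover have "inverse (real (Suc k)) \<le> 1" "0 \<le> inverse (1 + s k) * s k"
      using sy(1)[of k] by (auto simp: field_simps)
    ultimately have "inverse (real (Suc k)) * (inverse (1 + s k) * s k) \<le> 1"
      by (metis mult_le_one)
    then have "\<tau> k * s k \<le> 1"
      unfolding \<tau>_def by (simp add: ac_simps)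
    moreover have "0 \<le> \<tau> k * s k"
      using pos[of k] sy(1)[of k] by simp
    ultimately have "(1 - \<tau> k * s k) *\<^sub>R x + (\<tau> k * s k) *\<^sub>R y k \<in> \<Omega>"
      using assms sy(2)[of k] by (intro convexD_alt) auto
    then show ?thesis
      unfolding X_def sy(3) by (simp add: algebra_simps)
  qed
  moreover have "X \<longlonglongrightarrow> x"
    unfolding X_def using tendsto_add[OF tendsto_const tendsto_scaleR[OF \<tau>_lim lim]] by simp
  moreover have "(\<lambda>k. (X k - x) /\<^sub>R \<tau> k) \<longlonglongrightarrow> v"
    using lim pos[THEN less_imp_neq] unfolding X_def by simp
  ultimately show "v \<in> tangent_cone \<Omega> x"
    unfolding tangent_cone_def using pos \<tau>_lim by blast
qed

lemma closed_tangent_cone: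
  assumes "convex \<Omega>" "x \<in> \<Omega>"
  shows "closed (tangent_cone \<Omega> x)"
  using assms by (simp add: tangent_cone_eq_closure_conic_hull)

lemma convex_tangent_cone:
  assumes "convex \<Omega>" "x \<in> \<Omega>"
  shows "convex (tangent_cone \<Omega> x)"
proof -
  have "convex ((\<lambda>y. y - x) ` \<Omega>)"
    using assms by (auto intro: convex_translation_subtract)
  then show ?thesis
    using assms by (simp add: tangent_cone_eq_closure_conic_hull convex_conic_hull)
qed

lemma conic_tangent_cone:
  fixes x :: "'a::euclidean_space"
  assumes "convex \<Omega>" "x \<in> \<Omega>"
  shows "conic (tangent_cone \<Omega> x)"
  using assms by (simp add: tangent_cone_eq_closure_conic_hull conic_closure conic_conic_hull)

lemma diff_in_tangent_cone:
  assumes "convex \<Omega>" "x \<in> \<Omega>" "y \<in> \<Omega>"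
  shows "y - x \<in> tangent_cone \<Omega> x"
proof -
  have "y - x \<in> conic hull ((\<lambda>y. y - x) ` \<Omega>)"
    using assms(3) by (intro hull_inc) auto
  then show ?thesis
    using closure_subset assms by (auto simp: tangent_cone_eq_closure_conic_hull)
qed

text \<open>
  A linear inequality on \<open>\<Omega>\<close> based at \<open>x\<close> passes to difference quotients and then to their limits.
\<close>

lemma tangent_cone_inner_le_zero:
  fixes x :: "'a::real_inner"
  assumes normal: "\<And>y. y \<in> \<Omega> \<Longrightarrow> (y - x) \<bullet> h \<le> 0" and v: "v \<in> tangent_cone \<Omega> x"
  shows "v \<bullet> h \<le> 0"
proof -
  obtain X and \<tau> :: "nat \<Rightarrow> real" where X: "\<And>k. X k \<in> \<Omega>" "\<And>k. \<tau> k > 0"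
    and lim: "(\<lambda>k. (X k - x) /\<^sub>R \<tau> k) \<longlonglongrightarrow> v"
    using v unfolding tangent_cone_def by auto
  have "(\<lambda>k. ((X k - x) /\<^sub>R \<tau> k) \<bullet> h) \<longlonglongrightarrow> v \<bullet> h"
    by (intro tendsto_intros lim)
  moreover have "((X k - x) /\<^sub>R \<tau> k) \<bullet> h \<le> 0" for k
    using normal[OF X(1)[of k]] X(2)[of k] by (simp add: mult_nonneg_nonpos)
  ultimately show ?thesis
    by (intro LIMSEQ_le_const2) auto
qed

text \<open>
  The nearest point \<open>p\<close> of a convex cone satisfies \<open>(w - p) \<bullet> (q - p) \<le> 0\<close> for all \<open>q\<close> in the
  cone; the choice \<open>q = p + z\<close>, available because a convex cone is closed under addition, removes
  the unwanted \<open>p\<close>.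
\<close>

lemma closest_point_cone_residual:
  fixes w :: "'a::euclidean_space"
  assumes "convex T" "conic T" "closed T" "z \<in> T"
  shows "(w - closest_point T w) \<bullet> z \<le> 0"
proof -
  have "closest_point T w \<in> T"
    using assms by (intro closest_point_in_set) auto
  then have "(1/2) *\<^sub>R closest_point T w + (1/2) *\<^sub>R z \<in> T"
    using assms by (intro convexD) auto
  then have "2 *\<^sub>R ((1/2) *\<^sub>R closest_point T w + (1/2) *\<^sub>R z) \<in> T"
    using assms(2) by (intro conicD) auto
  then have "closest_point T w + z \<in> T"
    by (simp add: scaleR_right_distrib)
  from closest_point_dot[OF assms(1,3) this, of w] show ?thesis
    by simp
qed

section \<open>Subgradients and minimizers\<close>

lemma projected_subgradient_dissipation:
  fixes x :: "'a::euclidean_space"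
  assumes "convex \<Omega>" "\<Omega> \<subseteq> D" "v \<in> projected_subgradient D \<Omega> f x" "y \<in> \<Omega>"
  shows "(x - y) \<bullet> v \<le> f y - f x"
proof -
  have x: "x \<in> \<Omega>"
    using assms(3) unfolding projected_subgradient_def by (auto split: if_splits)
  obtain g where g: "g \<in> subdifferential D f x" and v: "v = closest_point (tangent_cone \<Omega> x) (- g)"
    using assms(3) x unfolding projected_subgradient_def by auto
  have "f x + (y - x) \<bullet> g \<le> f y"
    using g assms(2,4) unfolding subdifferential_def by auto
  moreover have "(- g - v) \<bullet> (y - x) \<le> 0"
    unfolding v using assms(1,4) x
    by (intro closest_point_cone_residual convex_tangent_cone conic_tangent_cone
        closed_tangent_cone diff_in_tangent_cone)
  ultimately show ?thesis
    by (simp add: inner_diff inner_commute)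
qed

text \<open>
  Openness of \<open>D\<close> is what makes the separating hyperplane nonvertical: a vertical one would have a
  normal \<open>a\<close> for which \<open>a \<bullet> y\<close> attains its minimum over \<open>D\<close> at the interior point \<open>x\<close>.
\<close>

lemma minimizer_imp_normal_subgradient:
  fixes f :: "'a::euclidean_space \<Rightarrow> real"
  assumes "open D" "convex_on D f" "convex \<Omega>" "\<Omega> \<subseteq> D" "x \<in> \<Omega>"
    and min: "\<And>y. y \<in> \<Omega> \<Longrightarrow> f x \<le> f y"
  obtains g where "g \<in> subdifferential D f x" "\<And>y. y \<in> \<Omega> \<Longrightarrow> 0 \<le> (y - x) \<bullet> g"
proof -
  define A where "A = {(y, r). y \<in> D \<and> f y - f x < r}"
  define B where "B = \<Omega> \<times> {..0::real}"
  have xD: "x \<in> D"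
    using assms by blast
  have "convex A"
  proof (rule convexI)
    fix p q :: "'a \<times> real" and u v :: real
    assume pq: "p \<in> A" "q \<in> A" and uv: "0 \<le> u" "0 \<le> v" "u + v = 1"
    have D: "fst p \<in> D" "fst q \<in> D" and lt: "f (fst p) - f x < snd p" "f (fst q) - f x < snd q"
      using pq unfolding A_def by auto
    have le: "f (u *\<^sub>R fst p + v *\<^sub>R fst q) \<le> u * f (fst p) + v * f (fst q)"
      using assms(2) D uv unfolding convex_on_def by blast
    have conv: "u *\<^sub>R fst p + v *\<^sub>R fst q \<in> D"
      using convex_on_imp_convex[OF assms(2)] D uv by (intro convexD) auto
    have "u * (f (fst p) - f x) + v * (f (fst q) - f x) < u * snd p + v * snd q"
    proof (cases "u = 0")
      case True
      then show ?thesis using uv lt by auto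
    next
      case False
      then have "u * (f (fst p) - f x) < u * snd p"
        using uv lt by auto
      moreover have "v * (f (fst q) - f x) \<le> v * snd q"
        using uv lt by (intro mult_left_mono) auto
      ultimately show ?thesis by simp
    qed
    moreover have "u * (f (fst p) - f x) + v * (f (fst q) - f x)
        = u * f (fst p) + v * f (fst q) - (u + v) * f x"
      by (simp add: algebra_simps)
    ultimately have "f (u *\<^sub>R fst p + v *\<^sub>R fst q) - f x < u * snd p + v * snd q"
      using le uv by simp
    then show "u *\<^sub>R p + v *\<^sub>R q \<in> A"
      unfolding A_def using conv by (simp add: case_prod_unfold)
  qed
  moreover have "convex B"
    unfolding B_def using assms(3) by (intro convex_Times) auto
  moreover have "(x, 1) \<in> A" "(x, 0) \<in> B"
    unfolding A_def B_def using xD assms(5) by auto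
  moreover have "B \<inter> A = {}"
    unfolding A_def B_def using min by fastforce
  ultimately obtain n \<beta> where n: "n \<noteq> 0" "\<forall>p\<in>B. n \<bullet> p \<le> \<beta>" "\<forall>p\<in>A. n \<bullet> p \<ge> \<beta>"
    using separating_hyperplane_sets[of B A] by blast
  obtain a \<alpha> where n_eq: "n = (a, \<alpha>)"
    by (cases n)
  have B_le: "a \<bullet> y + \<alpha> * r \<le> \<beta>" if "y \<in> \<Omega>" "r \<le> 0" for y r
    using n(2) that unfolding B_def n_eq by auto
  have A_ge: "\<beta> \<le> a \<bullet> y + \<alpha> * r" if "y \<in> D" "f y - f x < r" for y r
    using n(3) that unfolding A_def n_eq by auto
  have A_ge': "\<beta> \<le> a \<bullet> y + \<alpha> * (f y - f x)" if "y \<in> D" for y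
  proof (rule tendsto_lowerbound)
    show "((\<lambda>e. a \<bullet> y + \<alpha> * (f y - f x + e)) \<longlongrightarrow> a \<bullet> y + \<alpha> * (f y - f x)) (at_right 0)"
      by (auto intro!: tendsto_eq_intros)
    show "\<forall>\<^sub>F e in at_right 0. \<beta> \<le> a \<bullet> y + \<alpha> * (f y - f x + e)"
      using A_ge[OF that] by (auto simp: eventually_at_right_less intro: eventually_at_rightI[of 0 1])
  qed simp
  have \<beta>: "\<beta> = a \<bullet> x"
    using A_ge'[OF xD] B_le[OF assms(5), of 0] by simp
  have "\<alpha> \<ge> 0"
    using A_ge[OF xD, of 1] \<beta> by simp
  moreover have "\<alpha> \<noteq> 0"
  proof
    assume "\<alpha> = 0"
    then have "a \<noteq> 0"
      using n(1) n_eq by (auto simp: zero_prod_def)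
    obtain \<epsilon> where \<epsilon>: "\<epsilon> > 0" "cball x \<epsilon> \<subseteq> D"
      using assms(1) xD open_contains_cball by blast
    have "x - (\<epsilon> / norm a) *\<^sub>R a \<in> D"
      using \<epsilon> \<open>a \<noteq> 0\<close> by (intro subsetD[OF \<epsilon>(2)]) (auto simp: dist_norm)
    from A_ge'[OF this] have "(\<epsilon> / norm a) * (a \<bullet> a) \<le> 0"
      using \<open>\<alpha> = 0\<close> \<beta> by (simp add: inner_diff_right)
    moreover have "0 < (\<epsilon> / norm a) * (a \<bullet> a)"
      using \<epsilon>(1) \<open>a \<noteq> 0\<close> by (intro mult_pos_pos) auto
    ultimately show False
      by simp
  qed
  ultimately have \<alpha>: "\<alpha> > 0"
    by simp
  define g where "g = - (a /\<^sub>R \<alpha>)"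
  have g: "(y - x) \<bullet> g = (a \<bullet> x - a \<bullet> y) / \<alpha>" for y
    unfolding g_def by (simp add: inner_diff inner_commute[of _ a] divide_inverse algebra_simps)
  have "f y \<ge> f x + (y - x) \<bullet> g" if "y \<in> D" for y
    using A_ge'[OF that] \<alpha> unfolding g \<beta> by (simp add: field_simps)
  then have "g \<in> subdifferential D f x"
    unfolding subdifferential_def by blast
  moreover have "0 \<le> (y - x) \<bullet> g" if "y \<in> \<Omega>" for y
    using B_le[OF that, of 0] \<alpha> unfolding g \<beta> by simp
  ultimately show ?thesis
    using that by blast
qed

lemma minimizer_imp_equilibrium:
  fixes f :: "'a::euclidean_space \<Rightarrow> real"
  assumes "open D" "convex_on D f" "convex \<Omega>" "\<Omega> \<subseteq> D" "x \<in> \<Omega>"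
    and min: "\<And>y. y \<in> \<Omega> \<Longrightarrow> f x \<le> f y"
  shows "equilibrium_point (projected_subgradient D \<Omega> f) x"
proof -
  obtain g where g: "g \<in> subdifferential D f x" and normal: "\<And>y. y \<in> \<Omega> \<Longrightarrow> 0 \<le> (y - x) \<bullet> g"
    using minimizer_imp_normal_subgradient assms by blast
  have "0 = closest_point (tangent_cone \<Omega> x) (- g)"
  proof (rule closest_point_unique)
    show "convex (tangent_cone \<Omega> x)" "closed (tangent_cone \<Omega> x)"
      using assms by (auto intro: convex_tangent_cone closed_tangent_cone)
    show "0 \<in> tangent_cone \<Omega> x"
      using diff_in_tangent_cone[of \<Omega> x x] assms by simp
    show "\<forall>z\<in>tangent_cone \<Omega> x. dist (- g) 0 \<le> dist (- g) z"
    proof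
      fix z assume z: "z \<in> tangent_cone \<Omega> x"
      have "z \<bullet> (- g) \<le> 0"
        by (rule tangent_cone_inner_le_zero[OF _ z]) (use normal in auto)
      then have "g \<bullet> g \<le> (- g - z) \<bullet> (- g - z)"
        using inner_ge_zero[of z] by (simp add: inner_diff inner_commute)
      then show "dist (- g) 0 \<le> dist (- g) z"
        by (simp add: dist_norm norm_le)
    qed
  qed
  then show ?thesis
    unfolding equilibrium_point_def projected_subgradient_def using g assms(5) by auto
qed

section \<open>Absolutely continuous functions\<close>

lemma absolutely_continuous_onD:
  assumes "absolutely_continuous_on S x" "\<epsilon> > 0"
  obtains \<delta> where "\<delta> > 0"
    "\<forall>d. d division_of \<Union>d \<and> \<Union>d \<subseteq> S \<and> (\<Sum>K\<in>d. Sup K - Inf K) < \<delta> \<longrightarrow>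
       (\<Sum>K\<in>d. norm (x (Sup K) - x (Inf K))) < \<epsilon>"
proof -
  have "\<exists>\<delta>>0. \<forall>d. d division_of \<Union>d \<and> \<Union>d \<subseteq> S \<and> (\<Sum>K\<in>d. Sup K - Inf K) < \<delta> \<longrightarrow>
      (\<Sum>K\<in>d. norm (x (Sup K) - x (Inf K))) < \<epsilon>"
    using assms(1)[unfolded absolutely_continuous_on_def, rule_format, OF assms(2)] .
  then show ?thesis
    by (elim exE conjE) (rule that)
qed

lemma absolutely_continuous_on_subset:
  assumes "absolutely_continuous_on S x" "T \<subseteq> S"
  shows "absolutely_continuous_on T x"
  unfolding absolutely_continuous_on_def
proof (intro allI impI)
  fix \<epsilon> :: real assume "\<epsilon> > 0"
  obtain \<delta> where "\<delta> > 0"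
    and \<delta>: "\<forall>d. d division_of \<Union>d \<and> \<Union>d \<subseteq> S \<and> (\<Sum>K\<in>d. Sup K - Inf K) < \<delta> \<longrightarrow>
      (\<Sum>K\<in>d. norm (x (Sup K) - x (Inf K))) < \<epsilon>"
    by (rule absolutely_continuous_onD[OF assms(1) \<open>\<epsilon> > 0\<close>])
  show "\<exists>\<delta>>0. \<forall>d. d division_of \<Union>d \<and> \<Union>d \<subseteq> T \<and> (\<Sum>K\<in>d. Sup K - Inf K) < \<delta> \<longrightarrow>
      (\<Sum>K\<in>d. norm (x (Sup K) - x (Inf K))) < \<epsilon>"
    using \<open>\<delta> > 0\<close> by (intro exI[of _ \<delta>] conjI allI impI \<delta>[rule_format])
      (use assms(2) in \<open>auto intro: order_trans\<close>)
qed

text \<open>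
  Meant for \<open>h = \<phi> \<circ> x\<close> with \<open>\<phi>\<close> Lipschitz on the range of \<open>x\<close>, such as a squared distance along a
  bounded curve.
\<close>

lemma absolutely_continuous_on_dominated:
  assumes x: "absolutely_continuous_on S x" and "M \<ge> 0"
    and dom: "\<And>s t. s \<in> S \<Longrightarrow> t \<in> S \<Longrightarrow> norm (h s - h t) \<le> M * norm (x s - x t)"
  shows "absolutely_continuous_on S h"
  unfolding absolutely_continuous_on_def
proof (intro allI impI)
  fix \<epsilon> :: real assume "\<epsilon> > 0"
  then have "\<epsilon> / (M + 1) > 0"
    using \<open>M \<ge> 0\<close> by simp
  obtain \<delta> where "\<delta> > 0"
    and \<delta>: "\<forall>d. d division_of \<Union>d \<and> \<Union>d \<subseteq> S \<and> (\<Sum>K\<in>d. Sup K - Inf K) < \<delta> \<longrightarrow>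
      (\<Sum>K\<in>d. norm (x (Sup K) - x (Inf K))) < \<epsilon> / (M + 1)"
    by (rule absolutely_continuous_onD[OF x \<open>\<epsilon> / (M + 1) > 0\<close>])
  have "(\<Sum>K\<in>d. norm (h (Sup K) - h (Inf K))) < \<epsilon>"
    if d: "d division_of \<Union>d" "\<Union>d \<subseteq> S" "(\<Sum>K\<in>d. Sup K - Inf K) < \<delta>" for d
  proof -
    have "(\<Sum>K\<in>d. norm (h (Sup K) - h (Inf K))) \<le> (\<Sum>K\<in>d. (M + 1) * norm (x (Sup K) - x (Inf K)))"
    proof (rule sum_mono)
      fix K assume K: "K \<in> d"
      then obtain u v where uv: "K = {u..v}" "u \<le> v"
        using division_ofD(3,4)[OF d(1) K] by (metis atLeastatMost_empty_iff box_real(2))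
      then have "Sup K \<in> K" "Inf K \<in> K"
        by auto
      then have "Sup K \<in> S" "Inf K \<in> S"
        using d(2) K by blast+
      from dom[OF this] show "norm (h (Sup K) - h (Inf K)) \<le> (M + 1) * norm (x (Sup K) - x (Inf K))"
        by (smt (verit) mult_right_mono norm_ge_zero)
    qed
    also have "\<dots> = (M + 1) * (\<Sum>K\<in>d. norm (x (Sup K) - x (Inf K)))"
      by (simp add: sum_distrib_left)
    also have "\<dots> < (M + 1) * (\<epsilon> / (M + 1))"
      using \<delta>[rule_format, of d] d \<open>M \<ge> 0\<close> by (intro mult_strict_left_mono) auto
    finally show ?thesis
      using \<open>M \<ge> 0\<close> by simp
  qed
  then show "\<exists>\<delta>>0. \<forall>d. d division_of \<Union>d \<and> \<Union>d \<subseteq> S \<and> (\<Sum>K\<in>d. Sup K - Inf K) < \<delta> \<longrightarrow>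
      (\<Sum>K\<in>d. norm (h (Sup K) - h (Inf K))) < \<epsilon>"
    using \<open>\<delta> > 0\<close> by (intro exI[of _ \<delta>]) simp
qed

lemma absolutely_continuous_imp_continuous_on:
  fixes x :: "real \<Rightarrow> 'a::real_normed_vector"
  assumes "absolutely_continuous_on {a..b} x"
  shows "continuous_on {a..b} x"
  unfolding continuous_on_iff
proof (intro ballI allI impI)
  fix t \<epsilon> :: real assume t: "t \<in> {a..b}" and "\<epsilon> > 0"
  obtain \<delta> where "\<delta> > 0"
    and \<delta>: "\<forall>d. d division_of \<Union>d \<and> \<Union>d \<subseteq> {a..b} \<and> (\<Sum>K\<in>d. Sup K - Inf K) < \<delta> \<longrightarrow>
      (\<Sum>K\<in>d. norm (x (Sup K) - x (Inf K))) < \<epsilon>"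
    by (rule absolutely_continuous_onD[OF assms \<open>\<epsilon> > 0\<close>])
  have less: "norm (x v - x u) < \<epsilon>" if "u \<le> v" "u \<in> {a..b}" "v \<in> {a..b}" "v - u < \<delta>" for u v
  proof -
    have "{{u..v}} division_of \<Union>{{u..v}}"
      using division_of_self[of u v] \<open>u \<le> v\<close> by simp
    with \<delta>[rule_format, of "{{u..v}}"] show ?thesis
      using that by auto
  qed
  show "\<exists>d>0. \<forall>s\<in>{a..b}. dist s t < d \<longrightarrow> dist (x s) (x t) < \<epsilon>"
  proof (intro exI[of _ \<delta>] conjI ballI impI)
    fix s assume "s \<in> {a..b}" "dist s t < \<delta>"
    then show "dist (x s) (x t) < \<epsilon>"
      using less[of s t] less[of t s] t by (cases "s \<le> t") (auto simp: dist_norm norm_minus_commute)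
  qed (fact \<open>\<delta> > 0\<close>)
qed

lemma null_set_outer_open:
  fixes N :: "'a::euclidean_space set"
  assumes "N \<in> null_sets lebesgue" "\<delta> > 0"
  obtains G where "open G" "N \<subseteq> G" "G \<in> lmeasurable" "measure lebesgue G < \<delta>"
proof -
  obtain G where G: "open G" "N \<subseteq> G" "G - N \<in> lmeasurable" "emeasure lebesgue (G - N) < ennreal \<delta>"
    using sets_lebesgue_outer_open[OF _ assms(2)] assms(1) by blast
  have eq: "G = (G - N) \<union> N"
    using G(2) by blast
  have "emeasure lebesgue G = emeasure lebesgue (G - N)"
    by (subst eq, rule emeasure_Un_null_set) (use G assms(1) in auto)
  then have em: "emeasure lebesgue G < ennreal \<delta>"
    using G(4) by simp
  have "G \<in> lmeasurable"
    using G(1) em by (intro fmeasurableI) (auto simp: less_top[symmetric] intro: order.strict_trans)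
  moreover have "measure lebesgue G < \<delta>"
    using em assms(2) calculation by (simp add: emeasure_eq_measure2 ennreal_less_iff)
  ultimately show ?thesis
    using that G by blast
qed

text \<open>
  A gauge argument in the manner of Henstock. Off the exceptional null set \<open>N\<close> the gauge is so small
  that the increment over a tagged interval is at most \<open>c + e\<close> times its length; at points of \<open>N\<close>
  it stays inside an open set \<open>G\<close> of tiny measure, so that absolute continuity makes the total
  increment over the intervals tagged in \<open>N\<close> negligible. Summing over a fine division of \<open>{a..b}\<close>
  telescopes to \<open>g b - g a\<close>.
\<close>

lemma absolutely_continuous_increment_le:
  fixes g :: "real \<Rightarrow> real"
  assumes "a \<le> b" and ac: "absolutely_continuous_on {a..b} g"
    and deriv: "AE t in lebesgue. t \<in> {a..b} \<longrightarrow>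
      (\<exists>v. (g has_vector_derivative v) (at t within {a..b}) \<and> v \<le> c)"
  shows "g b - g a \<le> c * (b - a)"
proof (rule field_le_epsilon)
  fix \<epsilon> :: real assume "\<epsilon> > 0"
  define e where "e = \<epsilon> / (b - a + 2)"
  have "e > 0"
    unfolding e_def using \<open>\<epsilon> > 0\<close> \<open>a \<le> b\<close> by simp
  obtain N where N: "N \<in> null_sets lebesgue"
    and N_deriv: "\<And>t. t \<in> {a..b} \<Longrightarrow> t \<notin> N \<Longrightarrow>
      \<exists>v. (g has_vector_derivative v) (at t within {a..b}) \<and> v \<le> c"
    using deriv unfolding eventually_ae_filter by (auto simp: subset_iff) blast
  obtain \<delta>' where "\<delta>' > 0"
    and \<delta>': "\<forall>d. d division_of \<Union>d \<and> \<Union>d \<subseteq> {a..b} \<and> (\<Sum>K\<in>d. Sup K - Inf K) < \<delta>' \<longrightarrow>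
      (\<Sum>K\<in>d. norm (g (Sup K) - g (Inf K))) < e"
    by (rule absolutely_continuous_onD[OF ac \<open>e > 0\<close>])
  \<comment> \<open>The second bound absorbs the term \<open>c * length\<close> that is missing for intervals tagged in \<open>N\<close>
      when \<open>c\<close> is negative.\<close>
  define \<delta> where "\<delta> = min \<delta>' (e / (\<bar>c\<bar> + 1))"
  have "\<delta> > 0"
    unfolding \<delta>_def using \<open>\<delta>' > 0\<close> \<open>e > 0\<close> by (simp add: add_nonneg_pos)
  then obtain G where G: "open G" "N \<subseteq> G" "G \<in> lmeasurable" "measure lebesgue G < \<delta>"
    using null_set_outer_open[OF N] by blast
  have "\<exists>r>0. \<forall>s\<in>{a..b}. \<bar>s - t\<bar> < r \<longrightarrow>
      (t \<le> s \<longrightarrow> g s - g t \<le> (c + e) * (s - t)) \<and> (s \<le> t \<longrightarrow> g t - g s \<le> (c + e) * (t - s))"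
    if t: "t \<in> {a..b}" "t \<notin> N" for t
  proof -
    obtain v where v: "(g has_derivative (\<lambda>h. h *\<^sub>R v)) (at t within {a..b})" "v \<le> c"
      using N_deriv[OF t] unfolding has_vector_derivative_def by blast
    obtain r where r: "r > 0"
      "\<And>s. s \<in> {a..b} \<Longrightarrow> \<bar>s - t\<bar> < r \<Longrightarrow> \<bar>g s - g t - (s - t) * v\<bar> \<le> e * \<bar>s - t\<bar>"
      using v(1) \<open>e > 0\<close> unfolding has_derivative_within_alt by auto
    have "(t \<le> s \<longrightarrow> g s - g t \<le> (c + e) * (s - t)) \<and> (s \<le> t \<longrightarrow> g t - g s \<le> (c + e) * (t - s))"
      if s: "s \<in> {a..b}" "\<bar>s - t\<bar> < r" for s
    proof (intro conjI impI)
      assume "t \<le> s"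
      then have "(s - t) * v \<le> (s - t) * c"
        using v(2) by (intro mult_left_mono) auto
      then show "g s - g t \<le> (c + e) * (s - t)"
        using r(2)[OF s] \<open>t \<le> s\<close> by (simp add: algebra_simps)
    next
      assume "s \<le> t"
      then have "(t - s) * v \<le> (t - s) * c"
        using v(2) by (intro mult_left_mono) auto
      then show "g t - g s \<le> (c + e) * (t - s)"
        using r(2)[OF s] \<open>s \<le> t\<close> by (simp add: algebra_simps)
    qed
    with r(1) show ?thesis by blast
  qed
  then obtain r where r_pos: "\<And>t. t \<in> {a..b} \<Longrightarrow> t \<notin> N \<Longrightarrow> r t > 0"
    and r: "\<And>t s. t \<in> {a..b} \<Longrightarrow> t \<notin> N \<Longrightarrow> s \<in> {a..b} \<Longrightarrow> \<bar>s - t\<bar> < r t \<Longrightarrow>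
      (t \<le> s \<longrightarrow> g s - g t \<le> (c + e) * (s - t)) \<and> (s \<le> t \<longrightarrow> g t - g s \<le> (c + e) * (t - s))"
    by metis
  define \<gamma> where "\<gamma> t = (if t \<in> N then G else if t \<in> {a..b} then ball t (r t) else ball t 1)" for t
  have "gauge \<gamma>"
    unfolding gauge_def \<gamma>_def using G r_pos by auto
  then obtain p where p: "p tagged_division_of {a..b}" "\<gamma> fine p"
    using fine_division_exists_real by blast
  have fin: "finite p"
    using p by blast
  have interval: "\<exists>u v. K = {u..v} \<and> u \<le> v \<and> u \<in> {a..b} \<and> v \<in> {a..b} \<and> t \<in> {u..v}"
    if tK: "(t, K) \<in> p" for t K
  proof -
    obtain u v where "K = {u..v}"
      using tagged_division_ofD(4)[OF p(1) tK] by auto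
    with tagged_division_ofD(2,3)[OF p(1) tK] show ?thesis
      by (intro exI[of _ u] exI[of _ v]) auto
  qed
  define q where "q = {tK \<in> p. fst tK \<in> N}"
  have "q tagged_partial_division_of {a..b}"
    using p(1) tagged_partial_division_subset[of p "{a..b}" q] unfolding q_def tagged_division_of_def
    by blast
  then have div: "(snd ` q) division_of \<Union>(snd ` q)" and q: "q tagged_division_of \<Union>(snd ` q)"
    by (auto intro: partial_division_of_tagged_division tagged_partial_division_of_Union_self)
  have q_sum: "(\<Sum>(t,K)\<in>q. \<phi> K) = (\<Sum>K\<in>snd ` q. \<phi> K)"
    if "\<And>u v. v \<le> u \<Longrightarrow> \<phi> {u..v} = 0" for \<phi> :: "real set \<Rightarrow> real"
    by (rule sum.over_tagged_division_lemma[OF q]) (use that in auto)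
  have snd_q: "\<exists>u v. K = {u..v} \<and> u \<le> v" if "K \<in> snd ` q" for K
    using that interval unfolding q_def by force
  have len: "(\<Sum>K\<in>snd ` q. Sup K - Inf K) < \<delta>"
  proof -
    have "(\<Sum>K\<in>snd ` q. Sup K - Inf K) = (\<Sum>K\<in>snd ` q. measure lebesgue K)"
      using snd_q by (intro sum.cong) fastforce+
    also have "\<dots> = measure lebesgue (\<Union>(snd ` q))"
      by (rule content_division[OF div])
    also have "\<dots> \<le> measure lebesgue G"
    proof (rule measure_mono_fmeasurable)
      have "K \<subseteq> G" if "(t, K) \<in> q" for t K
        using that fineD[OF p(2)] unfolding q_def \<gamma>_def by force
      then show "\<Union>(snd ` q) \<subseteq> G"
        by force
      show "\<Union>(snd ` q) \<in> sets lebesgue"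
        using lmeasurable_division[OF div] by auto
    qed (use G in auto)
    finally show ?thesis
      using G(4) by simp
  qed
  have "\<Union>(snd ` q) \<subseteq> {a..b}"
    using interval unfolding q_def by fastforce
  then have var: "(\<Sum>K\<in>snd ` q. \<bar>g (Sup K) - g (Inf K)\<bar>) < e"
    using \<delta>'[rule_format, of "snd ` q"] div len unfolding \<delta>_def by auto
  have "(\<Sum>K\<in>snd ` q. Sup K - Inf K) \<ge> 0"
    using snd_q by (intro sum_nonneg) fastforce
  then have "\<bar>c\<bar> * (\<Sum>K\<in>snd ` q. Sup K - Inf K) \<le> \<bar>c\<bar> * (e / (\<bar>c\<bar> + 1))"
    using len unfolding \<delta>_def by (intro mult_left_mono) auto
  also have "\<dots> \<le> e"
    using \<open>e > 0\<close> by (auto simp: field_simps)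
  finally have c_len: "\<bar>c\<bar> * (\<Sum>K\<in>snd ` q. Sup K - Inf K) \<le> e" .
  define \<psi> where "\<psi> K = \<bar>g (Sup K) - g (Inf K)\<bar> + \<bar>c\<bar> * (Sup K - Inf K)" for K
  define \<psi>' where "\<psi>' K = (if interior K = {} then 0 else \<psi> K)" for K :: "real set"
  have local_bound: "g (Sup K) - g (Inf K) \<le> (c + e) * (Sup K - Inf K) + (if t \<in> N then \<psi>' K else 0)"
    if tK: "(t, K) \<in> p" for t K
  proof -
    obtain u v where uv: "K = {u..v}" "u \<le> v" "u \<in> {a..b}" "v \<in> {a..b}" "t \<in> {u..v}"
      using interval[OF tK] by blast
    show ?thesis
    proof (cases "t \<in> N")
      case True
      have "0 \<le> (\<bar>c\<bar> + c + e) * (v - u)"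
        using \<open>e > 0\<close> uv by (intro mult_nonneg_nonneg) auto
      then have "g v - g u \<le> (c + e) * (v - u) + \<psi> K"
        using uv unfolding \<psi>_def by (simp add: algebra_simps)
      moreover have "interior K = {} \<longleftrightarrow> u = v"
        using uv by auto
      ultimately show ?thesis
        using True uv unfolding \<psi>'_def by auto
    next
      case False
      have "K \<subseteq> ball t (r t)"
        using fineD[OF p(2) tK] False uv unfolding \<gamma>_def by auto
      moreover have "u \<in> K" "v \<in> K"
        using uv by auto
      ultimately have "u \<in> ball t (r t)" "v \<in> ball t (r t)"
        by blast+
      then have "g t - g u \<le> (c + e) * (t - u)" "g v - g t \<le> (c + e) * (v - t)"
        using r[of t u] r[of t v] uv False by (auto simp: dist_real_def)
      then show ?thesis
        using uv False by (simp add: algebra_simps)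
    qed
  qed
  have "g b - g a = (\<Sum>(t,K)\<in>p. g (Sup K) - g (Inf K))"
    by (rule additive_tagged_division_1[OF \<open>a \<le> b\<close> p(1), symmetric])
  also have "\<dots> \<le> (\<Sum>(t,K)\<in>p. (c + e) * (Sup K - Inf K) + (if t \<in> N then \<psi>' K else 0))"
    using local_bound by (intro sum_mono) auto
  also have "\<dots> = (c + e) * (\<Sum>(t,K)\<in>p. Sup K - Inf K) + (\<Sum>(t,K)\<in>p. if t \<in> N then \<psi>' K else 0)"
    by (simp add: case_prod_unfold sum.distrib sum_distrib_left)
  also have "(\<Sum>(t,K)\<in>p. Sup K - Inf K) = b - a"
    using additive_tagged_division_1[OF \<open>a \<le> b\<close> p(1), of "\<lambda>t. t"] by simp
  also have "(\<Sum>(t,K)\<in>p. if t \<in> N then \<psi>' K else 0) = (\<Sum>(t,K)\<in>q. \<psi>' K)"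
    unfolding q_def using fin by (simp add: sum.inter_filter case_prod_unfold)
  also have "\<dots> = (\<Sum>K\<in>snd ` q. \<psi>' K)"
    by (rule q_sum) (simp add: \<psi>'_def)
  also have "\<dots> \<le> (\<Sum>K\<in>snd ` q. \<psi> K)"
  proof (rule sum_mono)
    fix K assume "K \<in> snd ` q"
    then obtain u v where "K = {u..v}" "u \<le> v"
      using snd_q by blast
    then show "\<psi>' K \<le> \<psi> K"
      unfolding \<psi>'_def \<psi>_def by simp
  qed
  also have "\<dots> \<le> 2 * e"
    unfolding \<psi>_def sum.distrib sum_distrib_left[symmetric] using var c_len by simp
  finally have "g b - g a \<le> c * (b - a) + e * (b - a + 2)"
    by (simp add: algebra_simps)
  also have "e * (b - a + 2) = \<epsilon>"
    unfolding e_def using \<open>a \<le> b\<close> by simp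
  finally show "g b - g a \<le> c * (b - a) + \<epsilon>" .
qed

section \<open>Convergence of projected subgradient flows\<close>

text \<open>
  The rate \<open>c\<close> is left open because two values matter: \<open>0\<close> when \<open>y\<close> is a minimizer, and a
  negative rate as long as the cost stays away from its minimum.
\<close>

lemma flow_sq_distance_increment_le:
  fixes x :: "real \<Rightarrow> 'a::euclidean_space"
  assumes "convex \<Omega>" "\<Omega> \<subseteq> D" "y \<in> \<Omega>" "0 \<le> a" "a \<le> b"
    and sol: "caratheodory_solution (projected_subgradient D \<Omega> f) x"
    and rate: "\<And>t. t \<in> {a..b} \<Longrightarrow> x t \<in> \<Omega> \<Longrightarrow> f y - f (x t) \<le> c"
  shows "(norm (x b - y))\<^sup>2 / 2 - (norm (x a - y))\<^sup>2 / 2 \<le> c * (b - a)"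
proof -
  have "absolutely_continuous_on {0..b} x"
    using sol assms(4,5) unfolding caratheodory_solution_def by auto
  then have ac: "absolutely_continuous_on {a..b} x"
    by (rule absolutely_continuous_on_subset) (use assms in auto)
  then have "compact ((\<lambda>t. x t - y) ` {a..b})"
    by (intro compact_continuous_image continuous_intros absolutely_continuous_imp_continuous_on)
       auto
  then obtain M where M: "M > 0" "\<And>t. t \<in> {a..b} \<Longrightarrow> norm (x t - y) \<le> M"
    using compact_imp_bounded bounded_pos by (metis imageI)
  define \<phi> where "\<phi> t = (x t - y) \<bullet> (x t - y) / 2" for t
  have "absolutely_continuous_on {a..b} \<phi>"
  proof (rule absolutely_continuous_on_dominated[OF ac])
    fix s t assume st: "s \<in> {a..b}" "t \<in> {a..b}"
    have "\<phi> s - \<phi> t = (((x s - y) + (x t - y)) \<bullet> (x s - x t)) / 2"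
      unfolding \<phi>_def by (simp add: inner_diff inner_add inner_commute field_simps)
    then have "norm (\<phi> s - \<phi> t) = \<bar>((x s - y) + (x t - y)) \<bullet> (x s - x t)\<bar> / 2"
      by (simp only: real_norm_def abs_divide abs_numeral)
    also have "\<dots> \<le> norm ((x s - y) + (x t - y)) * norm (x s - x t) / 2"
      using Cauchy_Schwarz_ineq2 by (intro divide_right_mono) auto
    also have "\<dots> \<le> (M + M) * norm (x s - x t) / 2"
      using M(2)[OF st(1)] M(2)[OF st(2)]
      by (intro divide_right_mono mult_right_mono norm_triangle_le) auto
    finally show "norm (\<phi> s - \<phi> t) \<le> M * norm (x s - x t)"
      by simp
  qed (use M in auto)
  moreover have "AE t in lebesgue. t \<in> {a..b} \<longrightarrow>
      (\<exists>v. (\<phi> has_vector_derivative v) (at t within {a..b}) \<and> v \<le> c)"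
  proof -
    have "AE t in lebesgue. 0 \<le> t \<longrightarrow>
       (\<exists>v. (x has_vector_derivative v) (at t within {0..}) \<and> v \<in> projected_subgradient D \<Omega> f (x t))"
      using sol unfolding caratheodory_solution_def by blast
    then show ?thesis
    proof (rule eventually_mono, intro impI)
      fix t assume t: "t \<in> {a..b}" and "0 \<le> t \<longrightarrow>
        (\<exists>v. (x has_vector_derivative v) (at t within {0..}) \<and> v \<in> projected_subgradient D \<Omega> f (x t))"
      then obtain v where v: "(x has_vector_derivative v) (at t within {0..})"
        "v \<in> projected_subgradient D \<Omega> f (x t)"
        using assms(4) by auto
      have "x t \<in> \<Omega>"
        using v(2) unfolding projected_subgradient_def by (auto split: if_splits)
      then have "(x t - y) \<bullet> v \<le> c"
        using projected_subgradient_dissipation[OF assms(1,2) v(2) assms(3)] rate[OF t] by simp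
      moreover have "(x has_vector_derivative v) (at t within {a..b})"
        using v(1) by (rule has_vector_derivative_within_subset) (use assms(4) in auto)
      then have "(\<phi> has_vector_derivative ((x t - y) \<bullet> v)) (at t within {a..b})"
        unfolding \<phi>_def has_vector_derivative_def
        by (auto intro!: derivative_eq_intros simp: inner_commute field_simps)
      ultimately show "\<exists>v. (\<phi> has_vector_derivative v) (at t within {a..b}) \<and> v \<le> c"
        by blast
    qed
  qed
  ultimately have "\<phi> b - \<phi> a \<le> c * (b - a)"
    by (rule absolutely_continuous_increment_le[OF assms(5)])
  then show ?thesis
    unfolding \<phi>_def by (simp add: power2_norm_eq_inner)
qed

lemma flow_distance_to_minimizer_antimono:
  fixes x :: "real \<Rightarrow> 'a::euclidean_space"
  assumes "convex \<Omega>" "\<Omega> \<subseteq> D" "y \<in> \<Omega>" "0 \<le> a" "a \<le> b"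
    and sol: "caratheodory_solution (projected_subgradient D \<Omega> f) x"
    and min: "\<And>z. z \<in> \<Omega> \<Longrightarrow> f y \<le> f z"
  shows "norm (x b - y) \<le> norm (x a - y)"
proof -
  have "(norm (x b - y))\<^sup>2 / 2 - (norm (x a - y))\<^sup>2 / 2 \<le> 0 * (b - a)"
    by (rule flow_sq_distance_increment_le[OF assms(1-5) sol]) (use min in auto)
  then show ?thesis
    using power2_le_imp_le[of "norm (x b - y)" "norm (x a - y)"] by simp
qed

lemma flow_cost_approaches_minimum:
  fixes x :: "real \<Rightarrow> 'a::euclidean_space"
  assumes "convex \<Omega>" "\<Omega> \<subseteq> D" "y \<in> \<Omega>"
    and sol: "caratheodory_solution (projected_subgradient D \<Omega> f) x"
    and "\<eta> > 0"
  obtains t where "t \<ge> 0" "x t \<in> \<Omega>" "f (x t) < f y + \<eta>"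
proof (rule ccontr)
  assume none: "\<not> thesis"
  note found = that
  \<comment> \<open>By this time a squared distance that decreases at rate \<open>2 * \<eta>\<close> has become negative.\<close>
  define T where "T = ((norm (x 0 - y))\<^sup>2 / 2 + 1) / \<eta>"
  have "T \<ge> 0"
    unfolding T_def using \<open>\<eta> > 0\<close> by simp
  have "f y - f (x t) \<le> - \<eta>" if "t \<in> {0..T}" "x t \<in> \<Omega>" for t
    using that none found[of t] by force
  from flow_sq_distance_increment_le[OF assms(1-3) order_refl \<open>T \<ge> 0\<close> sol this]
  have "(norm (x T - y))\<^sup>2 / 2 - (norm (x 0 - y))\<^sup>2 / 2 \<le> - \<eta> * T"
    by simp
  moreover have "\<eta> * T = (norm (x 0 - y))\<^sup>2 / 2 + 1"
    unfolding T_def using \<open>\<eta> > 0\<close> by simp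
  ultimately show False
    using zero_le_power2[of "norm (x T - y)"] by simp
qed

text \<open>
  The distance to every minimizer is nonincreasing, but which minimizer is approached is not known in advance.
  The limit is therefore taken along a sequence of times first; monotonicity of the distance to that
  limit then extends the convergence to all times.
\<close>

theorem projected_subgradient_flow_converges:
  fixes x :: "real \<Rightarrow> 'a::euclidean_space"
  assumes "open D" "convex_on D f" "convex \<Omega>" "compact \<Omega>" "\<Omega> \<noteq> {}" "\<Omega> \<subseteq> D"
    and sol: "caratheodory_solution (projected_subgradient D \<Omega> f) x"
  obtains xs where "(x \<longlongrightarrow> xs) at_top" "xs \<in> \<Omega>" "\<And>y. y \<in> \<Omega> \<Longrightarrow> f xs \<le> f y"
proof -
  have cont: "continuous_on \<Omega> f"
    using convex_on_continuous[OF assms(1,2)] assms(6) continuous_on_subset by blast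
  then obtain y where y: "y \<in> \<Omega>" and y_min: "\<And>z. z \<in> \<Omega> \<Longrightarrow> f y \<le> f z"
    using continuous_attains_inf[OF assms(4,5)] by blast
  have "\<exists>t\<ge>0. x t \<in> \<Omega> \<and> f (x t) < f y + inverse (real (Suc k))" for k
    using flow_cost_approaches_minimum[OF assms(3,6) y sol, of "inverse (real (Suc k))"] by auto
  then obtain t where t: "\<And>k. t k \<ge> 0" "\<And>k. x (t k) \<in> \<Omega>"
    "\<And>k. f (x (t k)) < f y + inverse (real (Suc k))"
    by metis
  obtain xs r where xs: "xs \<in> \<Omega>" and r: "strict_mono r" and lim: "((\<lambda>k. x (t k)) \<circ> r) \<longlonglongrightarrow> xs"
    using assms(4) t(2) unfolding compact_def by metis
  have "f xs \<le> f y"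
  proof (rule LIMSEQ_le)
    show "(f \<circ> ((\<lambda>k. x (t k)) \<circ> r)) \<longlonglongrightarrow> f xs"
      using cont lim t(2) xs unfolding continuous_on_sequentially by auto
    show "((\<lambda>k. f y + inverse (real (Suc k))) \<circ> r) \<longlonglongrightarrow> f y"
      by (rule LIMSEQ_subseq_LIMSEQ[OF LIMSEQ_inverse_real_of_nat_add r])
    show "\<exists>N. \<forall>n\<ge>N. (f \<circ> ((\<lambda>k. x (t k)) \<circ> r)) n \<le> ((\<lambda>k. f y + inverse (real (Suc k))) \<circ> r) n"
      using t(3) by (auto intro: less_imp_le)
  qed
  then have xs_min: "f xs \<le> f z" if "z \<in> \<Omega>" for z
    using y_min[OF that] by simp
  have "(x \<longlongrightarrow> xs) at_top"
  proof (rule tendstoI)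
    fix \<epsilon> :: real assume "\<epsilon> > 0"
    then obtain k where k: "dist (x (t (r k))) xs < \<epsilon>"
      using lim unfolding lim_sequentially by fastforce
    have "dist (x s) xs < \<epsilon>" if "s \<ge> t (r k)" for s
      using flow_distance_to_minimizer_antimono[OF assms(3,6) xs t(1) that sol xs_min] k
      by (simp add: dist_norm)
    then show "\<forall>\<^sub>F s in at_top. dist (x s) xs < \<epsilon>"
      by (rule eventually_at_top_linorderI)
  qed
  then show ?thesis
    using that xs xs_min by blast
qed

section \<open>Products and the penalized cost\<close>

lemma open_product_set:
  assumes "\<And>i. open (S i)"
  shows "open (product_set S)"
  unfolding product_set_def using assms by (simp add: open_vector_box)

lemma convex_product_set:
  fixes S :: "'n::finite \<Rightarrow> 'a::real_vector set"
  assumes "\<And>i. convex (S i)"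
  shows "convex (product_set S)"
  using assms unfolding product_set_def convex_def by simp

lemma compact_product_set:
  fixes S :: "'n::finite \<Rightarrow> 'a::euclidean_space set"
  assumes "\<And>i. compact (S i)"
  shows "compact (product_set S)"
proof -
  have "\<exists>M. \<forall>i. \<forall>y\<in>S i. norm y \<le> M i"
    using compact_imp_bounded[OF assms] unfolding bounded_iff by metis
  then obtain M where M: "\<And>i y. y \<in> S i \<Longrightarrow> norm y \<le> M i"
    by blast
  have "norm x \<le> (\<Sum>i\<in>UNIV. M i)" if "x \<in> product_set S" for x
  proof -
    have "norm x \<le> (\<Sum>i\<in>UNIV. norm (x $ i))"
      unfolding norm_vec_def by (rule L2_set_le_sum) simp
    also have "\<dots> \<le> (\<Sum>i\<in>UNIV. M i)"
      using that M unfolding product_set_def by (intro sum_mono) auto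
    finally show ?thesis .
  qed
  then have "bounded (product_set S)"
    unfolding bounded_iff by blast
  moreover have "closed (product_set S)"
    unfolding product_set_def using assms by (simp add: closed_vector_box compact_imp_closed)
  ultimately show ?thesis
    by (simp add: compact_eq_bounded_closed)
qed

lemma convex_on_sum_functions:
  assumes "finite I" "convex S" "\<And>i. i \<in> I \<Longrightarrow> convex_on S (F i)"
  shows "convex_on S (\<lambda>x. \<Sum>i\<in>I. F i x)"
  using assms by (induction I rule: finite_induct) (auto simp: convex_on_const)

lemma l1_norm_add_le: "l1_norm (v + w) \<le> l1_norm v + l1_norm w"
  unfolding l1_norm_def by (simp add: sum.distrib[symmetric] sum_mono)

lemma l1_norm_scaleR: "l1_norm (c *\<^sub>R v) = \<bar>c\<bar> * l1_norm v"
  unfolding l1_norm_def by (simp add: abs_mult sum_distrib_left)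

lemma convex_on_l1_norm_diff:
  fixes S :: "((real ^ 'm::finite) ^ 'n::finite) set"
  assumes "convex S"
  shows "convex_on S (\<lambda>x. l1_norm (x $ i - x $ j))"
  unfolding convex_on_def
proof (intro conjI ballI allI impI assms)
  fix x y :: "(real ^ 'm) ^ 'n" and u v :: real
  assume uv: "0 \<le> u" "0 \<le> v"
  have "(u *\<^sub>R x + v *\<^sub>R y) $ i - (u *\<^sub>R x + v *\<^sub>R y) $ j
      = u *\<^sub>R (x $ i - x $ j) + v *\<^sub>R (y $ i - y $ j)"
    by (simp add: algebra_simps)
  then show "l1_norm ((u *\<^sub>R x + v *\<^sub>R y) $ i - (u *\<^sub>R x + v *\<^sub>R y) $ j)
      \<le> u * l1_norm (x $ i - x $ j) + v * l1_norm (y $ i - y $ j)"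
    using l1_norm_add_le[of "u *\<^sub>R (x $ i - x $ j)" "v *\<^sub>R (y $ i - y $ j)"] uv
    by (simp add: l1_norm_scaleR)
qed

lemma convex_on_penalized_cost:
  fixes f :: "'n::finite \<Rightarrow> real ^ 'm::finite \<Rightarrow> real"
  assumes "K \<ge> 0" "\<And>i. convex_on (D i) (f i)"
  shows "convex_on (product_set D) (penalized_cost E K f)"
proof -
  have conv: "convex (product_set D)"
    using assms(2) by (intro convex_product_set convex_on_imp_convex)
  have "convex_on (product_set D) (\<lambda>x. f i (x $ i))" for i
    using assms(2)[of i] conv unfolding convex_on_def product_set_def by simp
  then have "convex_on (product_set D) (\<lambda>x. (\<Sum>i\<in>UNIV. f i (x $ i))
      + K / 2 * (\<Sum>i\<in>UNIV. \<Sum>j\<in>neighbors E i. l1_norm (x $ i - x $ j)))"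
    using assms(1) conv
    by (intro convex_on_add convex_on_cmul convex_on_sum_functions convex_on_l1_norm_diff) auto
  then show ?thesis
    unfolding penalized_cost_def[abs_def] .
qed

section \<open>Convergence to an optimal equilibrium\<close>

theorem theorem1:
  fixes E :: "('n::finite \<times> 'n) set"
    and f :: "'n \<Rightarrow> real ^ 'm::finite \<Rightarrow> real"
    and D \<Omega> :: "'n \<Rightarrow> (real ^ 'm) set"
    and K c :: real
    and x :: "real \<Rightarrow> (real ^ 'm) ^ 'n"
    and x0 :: "(real ^ 'm) ^ 'n"
  defines "L \<equiv> penalized_cost E K f"
    and "F \<equiv> projected_subgradient (product_set D) (product_set \<Omega>) (penalized_cost E K f)"
  assumes undirected: "sym E"
    and K_nonneg: "K \<ge> 0"
    and domain: "\<And>i. open (D i)" "\<And>i. \<Omega> i \<subseteq> D i"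
    and f_convex: "\<And>i. convex_on (D i) (f i)"
    and \<Omega>_convex: "\<And>i. convex (\<Omega> i)"
    and \<Omega>_compact: "\<And>i. compact (\<Omega> i)"
    and interior_nonempty: "(\<Inter>i. interior (\<Omega> i)) \<noteq> {}"
    and c_pos: "c > 0"
    and f_lipschitz: "\<And>i y z. y \<in> \<Omega> i \<Longrightarrow> z \<in> \<Omega> i \<Longrightarrow> \<bar>f i y - f i z\<bar> \<le> c * norm (y - z)"
    and connected: "connected_graph E"
    and solution: "caratheodory_solution F x"
    and initial: "x 0 = x0" "x0 \<in> product_set \<Omega>"
  shows "\<exists>xs. (x \<longlongrightarrow> xs) at_top \<and> equilibrium_point F xs \<and>
              is_arg_min L (\<lambda>y. y \<in> product_set \<Omega>) xs"
proof -
  have cost: "convex_on (product_set D) L"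
    unfolding L_def using K_nonneg f_convex by (rule convex_on_penalized_cost)
  have sets: "open (product_set D)" "convex (product_set \<Omega>)" "compact (product_set \<Omega>)"
    using domain(1) \<Omega>_convex \<Omega>_compact
    by (simp_all add: open_product_set convex_product_set compact_product_set)
  have sub: "product_set \<Omega> \<subseteq> product_set D"
    using domain(2) unfolding product_set_def by blast
  have F: "F = projected_subgradient (product_set D) (product_set \<Omega>) L"
    unfolding F_def L_def ..
  obtain xs where xs: "(x \<longlongrightarrow> xs) at_top" "xs \<in> product_set \<Omega>"
    "\<And>y. y \<in> product_set \<Omega> \<Longrightarrow> L xs \<le> L y"
    using projected_subgradient_flow_converges[OF sets(1) cost sets(2,3) _ sub] solution initial(2)
    unfolding F by blast
  have "equilibrium_point F xs"
    unfolding F by (rule minimizer_imp_equilibrium[OF sets(1) cost sets(2) sub xs(2,3)])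
  moreover have "is_arg_min L (\<lambda>y. y \<in> product_set \<Omega>) xs"
    unfolding is_arg_min_def using xs(2,3) by (auto simp: not_less)
  ultimately show ?thesis
    using xs(1) by blast
qed

end
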